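(* For $p^*\in[0,1]$ such that $\int_{p^*}^1 Q(q)\,dq=\frac34$ it holds that $\mathbb{T}(p^* )\ge\frac12$.
   Context: There are $n\ge 1$ boxes with independent nonnegative rewards $v_1,\dots,v_n$ whose distributions have no point masses. $Z=\max_{i\in[n]}v_i$ (the prophet), normalized so that $\mathbb{E}[Z]=1$. The quantile function of $Z$ is $Q(p)=\sup\{x\mid \Pr[Z\le x]=p\}$ for $p\in[0,1]$ (values in $\mathbb{R}_{\ge0}\cup\{\infty\}$). Define $\mathbb{T}:[0,1]\to\mathbb{R}_{\ge0}$ by $\mathbb{T}(p)=p\int_p^1 \frac{Q(q)}{q^2}\,dq$ for $p\in(0,1]$, with $\mathbb{T}(0)=\lim_{p\to0^+}\mathbb{T}(p)$. *)

theory Defs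
  imports "HOL-Probability.Probability"
begin

definition prophet :: "nat \<Rightarrow> (nat \<Rightarrow> 'a \<Rightarrow> real) \<Rightarrow> 'a \<Rightarrow> real" where
  "prophet n v \<omega> = Max ((\<lambda>i. v i \<omega>) ` {1..n})"

text \<open>
  The supremum ranges over the extended half-line, so the set is never empty at level 1 and the
  quantile there is \<open>\<infinity>\<close>, also for an unbounded variable.
\<close>

definition quantile :: "'a measure \<Rightarrow> ('a \<Rightarrow> real) \<Rightarrow> real \<Rightarrow> ennreal" where
  "quantile M Z p = Sup {x :: ennreal. measure M {\<omega> \<in> space M. ennreal (Z \<omega>) \<le> x} = p}"

text \<open>
  For \<open>p > 0\<close> the integral is finite as soon as \<open>Z\<close> is integrable, so that \<open>enn2real\<close> is then
  only a change of type. Were the integral infinite, \<open>enn2real\<close> would give 0.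
\<close>

definition T_pos :: "'a measure \<Rightarrow> ('a \<Rightarrow> real) \<Rightarrow> real \<Rightarrow> real" where
  "T_pos M Z p = p * enn2real (\<integral>\<^sup>+q\<in>{p..1}. (quantile M Z q / ennreal (q\<^sup>2)) \<partial>lborel)"

definition T_fun :: "'a measure \<Rightarrow> ('a \<Rightarrow> real) \<Rightarrow> real \<Rightarrow> real" where
  "T_fun M Z p = (if p = 0 then Lim (at_right 0) (T_pos M Z) else T_pos M Z p)"

end

theory Submission
  imports Defs
begin

text \<open>
  Since \<open>Q\<close> is nondecreasing, the missing mass \<open>\<integral>_0^p Q = 1 - 3/4\<close> is at most \<open>p * Q p\<close>, so
  \<open>Q \<ge> a = 1 / (4 * p)\<close> on \<open>[p, 1]\<close>. Hence \<open>(Q q - a) * (1 / q^2 - 1) \<ge> 0\<close> there, that is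
  \<open>Q q / q^2 \<ge> Q q + a * (1 / q^2 - 1)\<close>, the extremal case being \<open>Q = a\<close> with the remaining mass at
  \<open>q = 1\<close>. Integrating gives \<open>T p \<ge> p + 1 / (4 * p) - 1 / 2\<close>, and the right-hand side is
  at least \<open>1 / 2\<close> by AM-GM.
\<close>

section \<open>The quantile function of a nonnegative variable without atoms\<close>

context prob_space
begin

text \<open>No probability lies outside \<open>{0..1}\<close>, and the supremum of the empty set in
  \<open>ennreal\<close> is 0. This default value enters the measurability proof on the whole
  line.\<close>

lemma quantile_eq_0_outside:
  assumes "q \<notin> {0..1}"
  shows "quantile M Z q = 0"
proof -
  have "{x::ennreal. prob {\<omega> \<in> space M. ennreal (Z \<omega>) \<le> x} = q} = {}"
    using assms by auto
  then show ?thesis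
    by (simp add: quantile_def bot_ennreal)
qed

text \<open>Without atoms the cdf is continuous; it vanishes at 0 and tends to 1, so the
  intermediate value theorem applies. Level 1 is left out because an unbounded variable reaches it
  only at infinity.\<close>

lemma quantile_level_attained:
  fixes Z :: "'a \<Rightarrow> real"
  assumes [measurable]: "random_variable borel Z"
    and nonneg: "AE \<omega> in M. Z \<omega> \<ge> 0"
    and atomless: "\<And>x. prob {\<omega> \<in> space M. Z \<omega> = x} = 0"
    and u: "0 < u" "u < 1"
  shows "\<exists>t\<ge>0. prob {\<omega> \<in> space M. Z \<omega> \<le> t} = u"
proof -
  interpret D: real_distribution "distr M borel Z"
    by simp
  have cdf_eq: "cdf (distr M borel Z) x = prob {\<omega> \<in> space M. Z \<omega> \<le> x}" for x
    unfolding cdf_def by (subst measure_distr) (auto intro!: arg_cong[where f = prob])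
  have "measure (distr M borel Z) {x} = 0" for x
    using atomless[of x] by (subst measure_distr) (auto simp: vimage_def Int_def conj_commute)
  then have cont: "continuous_on A (cdf (distr M borel Z))" for A
    by (simp add: D.isCont_cdf continuous_at_imp_continuous_on)
  have "AE \<omega> in M. Z \<omega> \<noteq> 0"
    using atomless[of 0] by (subst AE_iff_measurable[OF _ refl]) (auto simp: emeasure_eq_measure)
  with nonneg have "AE \<omega> in M. \<not> Z \<omega> \<le> 0"
    by eventually_elim auto
  then have zero: "cdf (distr M borel Z) 0 = 0"
    unfolding cdf_eq by (subst prob_eq_0) auto
  have "\<forall>\<^sub>F b in at_top. 0 \<le> b \<and> u < cdf (distr M borel Z) b"
    using order_tendstoD(1)[OF D.cdf_lim_at_top_prob u(2)] eventually_ge_at_top[of 0]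
    by eventually_elim simp
  then obtain b where "b \<ge> 0" "u \<le> cdf (distr M borel Z) b"
    by (auto dest!: eventually_happens simp: less_imp_le)
  then obtain t where "t \<ge> 0" "cdf (distr M borel Z) t = u"
    using IVT'[of "cdf (distr M borel Z)" 0 u b] cont zero u by auto
  then show ?thesis
    by (auto simp: cdf_eq)
qed

lemma quantile_upper:
  assumes "t \<ge> 0" "prob {\<omega> \<in> space M. Z \<omega> \<le> t} = u"
  shows "ennreal t \<le> quantile M Z u"
  using assms unfolding quantile_def by (intro Sup_upper) (simp add: ennreal_le_iff)

lemma quantile_mono_on:
  fixes Z :: "'a \<Rightarrow> real"
  assumes [measurable]: "random_variable borel Z"
    and nonneg: "AE \<omega> in M. Z \<omega> \<ge> 0"
    and atomless: "\<And>x. prob {\<omega> \<in> space M. Z \<omega> = x} = 0"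
  shows "mono_on {0..1} (quantile M Z)"
proof (rule mono_onI)
  fix q r :: real
  assume qr: "q \<in> {0..1}" "r \<in> {0..1}" "q \<le> r"
  show "quantile M Z q \<le> quantile M Z r"
  proof (cases "q = r")
    case False
    \<comment> \<open>Level \<open>r\<close> must be attained, as otherwise
      \<open>quantile M Z r\<close> would be the supremum of the empty set, which is 0. At
      \<open>r = 1\<close> the witness is \<top>.\<close>
    obtain y :: ennreal where y: "prob {\<omega> \<in> space M. ennreal (Z \<omega>) \<le> y} = r"
    proof (cases "r = 1")
      case True
      then show ?thesis
        using that[of \<top>] by (simp add: prob_space)
    next
      case False
      then obtain t where "t \<ge> 0" "prob {\<omega> \<in> space M. Z \<omega> \<le> t} = r"
        using quantile_level_attained[OF assms, of r] qr \<open>q \<noteq> r\<close> by auto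
      then show ?thesis
        using that[of "ennreal t"] by (simp add: ennreal_le_iff)
    qed
    have "x \<le> y" if "prob {\<omega> \<in> space M. ennreal (Z \<omega>) \<le> x} = q" for x
    proof (rule ccontr)
      assume "\<not> x \<le> y"
      then have "prob {\<omega> \<in> space M. ennreal (Z \<omega>) \<le> y} \<le> prob {\<omega> \<in> space M. ennreal (Z \<omega>) \<le> x}"
        by (intro finite_measure_mono) auto
      with that y qr False show False
        by simp
    qed
    then have "quantile M Z q \<le> y"
      unfolding quantile_def by (intro Sup_least) auto
    also have "y \<le> quantile M Z r"
      unfolding quantile_def using y by (intro Sup_upper) simp
    finally show ?thesis .
  qed simp
qed

text \<open>The quantile drops to 0 beyond 1, so it is not monotone on the whole line. Still, each
  set \<open>{q. y < quantile M Z q}\<close> lies in \<open>{0..1}\<close>, where monotonicity makes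
  it an interval.\<close>

lemma borel_measurable_quantile:
  fixes Z :: "'a \<Rightarrow> real"
  assumes "random_variable borel Z"
    and "AE \<omega> in M. Z \<omega> \<ge> 0"
    and "\<And>x. prob {\<omega> \<in> space M. Z \<omega> = x} = 0"
  shows "quantile M Z \<in> borel_measurable borel"
proof (rule borel_measurableI_greater)
  fix y
  have sub: "q \<in> {0..1}" if "y < quantile M Z q" for q
    using that quantile_eq_0_outside[of q Z] by fastforce
  have "y < quantile M Z r"
    if "y < quantile M Z a" "y < quantile M Z b" "a \<le> r" "r \<le> b" for a b r
  proof -
    have "quantile M Z a \<le> quantile M Z r"
      using sub[OF that(1)] sub[OF that(2)] that(3,4)
      by (intro mono_onD[OF quantile_mono_on[OF assms]]) auto
    with that(1) show ?thesis
      by (rule less_le_trans)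
  qed
  then have "is_interval {q. y < quantile M Z q}"
    unfolding is_interval_1 by blast
  then show "{q \<in> space borel. y < quantile M Z q} \<in> sets borel"
    by (simp add: real_interval_borel_measurable)
qed

text \<open>
  The pseudo-inverse of the cdf that is used in the library for Skorohod's theorem has the law of
  \<open>Z\<close> under the uniform distribution, and it is the lower quantile function, hence dominated by
  \<^const>\<open>quantile\<close>.
\<close>

lemma nn_integral_le_quantile:
  fixes Z :: "'a \<Rightarrow> real"
  assumes [measurable]: "random_variable borel Z"
    and nonneg: "AE \<omega> in M. Z \<omega> \<ge> 0"
    and atomless: "\<And>x. prob {\<omega> \<in> space M. Z \<omega> = x} = 0"
  shows "(\<integral>\<^sup>+\<omega>. ennreal (Z \<omega>) \<partial>M) \<le> (\<integral>\<^sup>+q\<in>{0..1}. quantile M Z q \<partial>lborel)"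
proof -
  interpret D: cdf_distribution "distr M borel Z"
    by (simp add: cdf_distribution_def)
  have cdf_eq: "D.C x = prob {\<omega> \<in> space M. Z \<omega> \<le> x}" for x
    unfolding cdf_def by (subst measure_distr) (auto intro!: arg_cong[where f = prob])
  have le: "ennreal (D.I q) \<le> quantile M Z q" if q: "0 < q" "q < 1" for q
  proof -
    obtain t where t: "t \<ge> 0" "prob {\<omega> \<in> space M. Z \<omega> \<le> t} = q"
      using quantile_level_attained[OF assms q] by auto
    \<comment> \<open>Galois connection: \<open>D.I q \<le> t\<close> iff
      \<open>q \<le> D.C t\<close>, and here \<open>D.C t = q\<close>.\<close>
    then have "D.I q \<le> t"
      using D.pseudoinverse[OF q, of t] by (simp add: cdf_eq)
    then have "ennreal (D.I q) \<le> ennreal t"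
      by (rule ennreal_leI)
    also have "\<dots> \<le> quantile M Z q"
      using t by (rule quantile_upper)
    finally show ?thesis .
  qed
  have I_meas: "D.I \<in> restrict_space lborel {0<..<1} \<rightarrow>\<^sub>M borel"
    using D.measurable_CI by (simp cong: measurable_cong_sets sets_restrict_space_cong)
  have "(\<integral>\<^sup>+\<omega>. ennreal (Z \<omega>) \<partial>M) = (\<integral>\<^sup>+x. ennreal x \<partial>distr M borel Z)"
    by (simp add: nn_integral_distr)
  also have "\<dots> = (\<integral>\<^sup>+x. ennreal x \<partial>distr (restrict_space lborel {0<..<1}) borel D.I)"
    by (simp only: D.distr_I_eq_M)
  also have "\<dots> = (\<integral>\<^sup>+q. ennreal (D.I q) \<partial>restrict_space lborel {0<..<1})"
    using I_meas by (subst nn_integral_distr) auto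
  also have "\<dots> = (\<integral>\<^sup>+q\<in>{0<..<1}. ennreal (D.I q) \<partial>lborel)"
    by (simp add: nn_integral_restrict_space)
  also have "\<dots> \<le> (\<integral>\<^sup>+q\<in>{0..1}. quantile M Z q \<partial>lborel)"
    using le by (intro nn_integral_mono) (auto split: split_indicator)
  finally show ?thesis .
qed

section \<open>The lower bound at a positive level\<close>

lemma T_pos_ge_half:
  fixes Z :: "'a \<Rightarrow> real"
  assumes rv: "random_variable borel Z"
    and nonneg: "AE \<omega> in M. Z \<omega> \<ge> 0"
    and atomless: "\<And>x. prob {\<omega> \<in> space M. Z \<omega> = x} = 0"
    and mean: "(\<integral>\<^sup>+\<omega>. ennreal (Z \<omega>) \<partial>M) = 1"
    and p: "0 < p" "p \<le> 1"
    and mass: "(\<integral>\<^sup>+q\<in>{p..1}. quantile M Z q \<partial>lborel) = ennreal (3 / 4)"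
  shows "1 / 2 \<le> T_pos M Z p"
proof -
  let ?Q = "quantile M Z"
  define a where "a = 1 / (4 * p)"
  have a: "a \<ge> 0"
    using p by (simp add: a_def)
  note [measurable] = borel_measurable_quantile[OF rv nonneg atomless]
  note Q_mono = mono_onD[OF quantile_mono_on[OF rv nonneg atomless]]
  have "1 \<le> (\<integral>\<^sup>+q\<in>{0..1}. ?Q q \<partial>lborel)"
    using nn_integral_le_quantile[OF rv nonneg atomless] mean by simp
  \<comment> \<open>On \<open>{0..p}\<close> the quantile is at most its value at \<open>p\<close>.
    The indicators overlap at \<open>p\<close>, which is harmless for an upper bound.\<close>
  also have "\<dots> \<le> (\<integral>\<^sup>+q. ?Q p * indicator {0..p} q + ?Q q * indicator {p..1} q \<partial>lborel)"
    using p by (intro nn_integral_mono) (auto split: split_indicator intro: Q_mono)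
  also have "\<dots> = ?Q p * ennreal p + ennreal (3 / 4)"
    using p mass by (simp add: nn_integral_add nn_integral_cmult)
  finally have "ennreal 1 \<le> ?Q p * ennreal p + ennreal (3 / 4)"
    by simp
  then have Qp: "ennreal a \<le> ?Q p"
    using p by (cases "?Q p")
      (auto simp: a_def divide_simps ennreal_le_iff mult_ac simp flip: ennreal_mult ennreal_plus)
  have Qa: "ennreal a \<le> ?Q q" if "q \<in> {p..1}" for q
    using Qp Q_mono[of p q] p that by auto

  have pointwise: "?Q q + ennreal (a * (1 / q\<^sup>2 - 1)) \<le> ?Q q / ennreal (q\<^sup>2)"
    if q: "q \<in> {p..1}" for q
  proof (cases "?Q q")
    case (real x)
    have q01: "0 < q" "q\<^sup>2 \<le> 1" "0 < q\<^sup>2"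
      using p q by (auto simp: power_le_one)
    then have inv: "1 / q\<^sup>2 - 1 \<ge> 0"
      by simp
    have "a \<le> x"
      using Qa[OF q] real by (simp add: ennreal_le_iff)
    then have "a * (1 / q\<^sup>2 - 1) \<le> x * (1 / q\<^sup>2 - 1)"
      using inv by (rule mult_right_mono)
    then have "x + a * (1 / q\<^sup>2 - 1) \<le> x / q\<^sup>2"
      by (simp add: algebra_simps)
    then show ?thesis
      using real a inv q01 by (simp add: divide_ennreal flip: ennreal_plus)
  \<comment> \<open>When the quantile is \<top>, as it always is at \<open>q = 1\<close>, both sides
    are \<top>.\<close>
  qed (auto simp: ennreal_top_divide)

  let ?T = "\<integral>\<^sup>+q\<in>{p..1}. (?Q q / ennreal (q\<^sup>2)) \<partial>lborel"
  have "((\<lambda>q. a * (- 1 / q - q)) has_real_derivative a * (1 / q\<^sup>2 - 1)) (at q)" if "p \<le> q" for q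
    using p that by (auto intro!: derivative_eq_intros simp: power2_eq_square field_simps)
  moreover have "0 \<le> a * (1 / q\<^sup>2 - 1)" if "p \<le> q" "q \<le> 1" for q
  proof -
    have "q\<^sup>2 \<le> 1" "0 < q\<^sup>2"
      using p that by (auto simp: power_le_one)
    then show ?thesis
      using a by simp
  qed
  ultimately have FTC: "(\<integral>\<^sup>+q\<in>{p..1}. ennreal (a * (1 / q\<^sup>2 - 1)) \<partial>lborel)
      = ennreal (a * (- 1 / 1 - 1) - a * (- 1 / p - p))"
    using p by (intro nn_integral_FTC_Icc) auto
  have gap: "a * (- 1 / 1 - 1) - a * (- 1 / p - p) = a * (1 - p)\<^sup>2 / p"
    using p by (simp add: field_simps power2_eq_square)
  have "ennreal (3 / 4) + ennreal (a * (1 - p)\<^sup>2 / p)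
      = (\<integral>\<^sup>+q\<in>{p..1}. ?Q q \<partial>lborel) + (\<integral>\<^sup>+q\<in>{p..1}. ennreal (a * (1 / q\<^sup>2 - 1)) \<partial>lborel)"
    by (simp only: mass FTC gap)
  also have "\<dots> = (\<integral>\<^sup>+q. ?Q q * indicator {p..1} q
      + ennreal (a * (1 / q\<^sup>2 - 1)) * indicator {p..1} q \<partial>lborel)"
    by (rule nn_integral_add[symmetric]) auto
  also have "\<dots> \<le> ?T"
    using pointwise by (intro nn_integral_mono) (auto split: split_indicator)
  finally have lower: "ennreal (3 / 4 + a * (1 - p)\<^sup>2 / p) \<le> ?T"
    using a p by (simp add: ennreal_plus)

  \<comment> \<open>The lower bound survives \<open>enn2real\<close> only if \<open>?T\<close> is
    finite, since \<open>enn2real \<top> = 0\<close>. Finiteness follows from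
    \<open>1 / q^2 \<le> 1 / p^2\<close> and the given mass.\<close>
  have "?Q q / ennreal (q\<^sup>2) \<le> ennreal (1 / p\<^sup>2) * ?Q q" if "q \<in> {p..1}" for q
  proof -
    have "p\<^sup>2 \<le> q\<^sup>2" "0 < p\<^sup>2"
      using p that by (auto intro: power_mono)
    then have "inverse (ennreal (q\<^sup>2)) \<le> ennreal (1 / p\<^sup>2)"
      using p that by (subst inverse_ennreal) (auto intro!: ennreal_leI simp: divide_simps)
    then show ?thesis
      by (simp add: divide_ennreal_def mult.commute mult_left_mono)
  qed
  then have "?T \<le> (\<integral>\<^sup>+q. ennreal (1 / p\<^sup>2) * (?Q q * indicator {p..1} q) \<partial>lborel)"
    by (intro nn_integral_mono) (auto split: split_indicator)
  also have "\<dots> = ennreal (1 / p\<^sup>2) * ennreal (3 / 4)"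
    by (subst nn_integral_cmult) (auto simp: mass)
  also have "\<dots> < \<top>"
    by (simp add: ennreal_mult_less_top)
  finally have "?T < \<top>" .
  then have "3 / 4 + a * (1 - p)\<^sup>2 / p \<le> enn2real ?T"
    using enn2real_mono[OF lower] a p by (simp del: ennreal_plus)
  then have "p * (3 / 4 + a * (1 - p)\<^sup>2 / p) \<le> T_pos M Z p"
    unfolding T_pos_def using p by (intro mult_left_mono) auto
  \<comment> \<open>AM-GM as a completed square; it vanishes exactly at
    \<open>p = 1 / 2\<close>.\<close>
  moreover have "p * (3 / 4 + a * (1 - p)\<^sup>2 / p) - 1 / 2 = (2 * p - 1)\<^sup>2 / (4 * p)"
    using p by (simp add: a_def field_simps power2_eq_square)
  moreover have "(2 * p - 1)\<^sup>2 / (4 * p) \<ge> 0"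
    using p by simp
  ultimately show ?thesis
    by linarith
qed

end

section \<open>Passing from the boxes to their maximum\<close>

theorem claim10:
  fixes M :: "'a measure" and n :: nat and v :: "nat \<Rightarrow> 'a \<Rightarrow> real"
    and Z :: "'a \<Rightarrow> real" and p :: real
  assumes "prob_space M"
    and "n \<ge> 1"
    and "prob_space.indep_vars M (\<lambda>_. borel) v {1..n}"
    and "\<And>i. i \<in> {1..n} \<Longrightarrow> AE \<omega> in M. v i \<omega> \<ge> 0"
    and "\<And>i x. i \<in> {1..n} \<Longrightarrow> measure M {\<omega> \<in> space M. v i \<omega> = x} = 0"
    and "Z = prophet n v"
    and "prob_space.expectation M Z = 1"
    and "p \<in> {0..1}"
    and "(\<integral>\<^sup>+q\<in>{p..1}. quantile M Z q \<partial>lborel) = ennreal (3 / 4)"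
  shows "T_fun M Z p \<ge> 1 / 2"
proof -
  interpret prob_space M
    by (rule assms(1))
  have v_meas [measurable]: "v i \<in> borel_measurable M" if "i \<in> {1..n}" for i
    using assms(3) that by (auto simp: indep_vars_def)
  have Z_eq: "Z = (\<lambda>\<omega>. Max ((\<lambda>i. v i \<omega>) ` {1..n}))"
    using assms(6) by (auto simp: prophet_def)
  have rv [measurable]: "random_variable borel Z"
    unfolding Z_eq by (rule borel_measurable_Max) (auto intro: v_meas)
  \<comment> \<open>As \<open>n \<ge> 1\<close>, the maximum is attained by some box. Nonnegativity
    thus passes to \<open>Z\<close>, and so does the absence of atoms, by a union bound.\<close>
  have Z_in: "Z \<omega> \<in> (\<lambda>i. v i \<omega>) ` {1..n}" for \<omega>
    unfolding Z_eq using assms(2) by (intro Max_in) auto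
  have "AE \<omega> in M. \<forall>i\<in>{1..n}. v i \<omega> \<ge> 0"
    using assms(4) by (intro AE_finite_allI) auto
  then have nonneg: "AE \<omega> in M. Z \<omega> \<ge> 0"
  proof eventually_elim
    case (elim \<omega>)
    then show ?case
      using Z_in[of \<omega>] by auto
  qed
  have atomless: "prob {\<omega> \<in> space M. Z \<omega> = x} = 0" for x
  proof -
    have "prob {\<omega> \<in> space M. Z \<omega> = x} \<le> prob (\<Union>i\<in>{1..n}. {\<omega> \<in> space M. v i \<omega> = x})"
    proof (intro finite_measure_mono subsetI)
      fix \<omega>
      assume "\<omega> \<in> {\<omega> \<in> space M. Z \<omega> = x}"
      then show "\<omega> \<in> (\<Union>i\<in>{1..n}. {\<omega> \<in> space M. v i \<omega> = x})"
        using Z_in[of \<omega>] by auto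
    qed auto
    also have "\<dots> \<le> (\<Sum>i\<in>{1..n}. prob {\<omega> \<in> space M. v i \<omega> = x})"
      by (intro finite_measure_subadditive_finite) auto
    also have "\<dots> = 0"
      using assms(5) by simp
    finally show ?thesis
      by (simp add: measure_le_0_iff)
  qed
  \<comment> \<open>The Bochner integral of a non-integrable function is 0, so expectation 1 forces
    integrability.\<close>
  have "integrable M Z"
    using assms(7) not_integrable_integral_eq by fastforce
  then have mean: "(\<integral>\<^sup>+\<omega>. ennreal (Z \<omega>) \<partial>M) = 1"
    using nn_integral_eq_integral[OF _ nonneg] assms(7) by simp
  \<comment> \<open>At \<open>p = 0\<close> the integral of the quantile would be at least the mean
    1, exceeding 3/4. Hence the limit branch of \<open>T_fun\<close> does not occur.\<close>
  have "p \<noteq> 0"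
  proof
    assume "p = 0"
    then have "ennreal 1 \<le> ennreal (3 / 4)"
      using nn_integral_le_quantile[OF rv nonneg atomless] mean assms(9) by simp
    then show False
      by (subst (asm) ennreal_le_iff) auto
  qed
  then show ?thesis
    using T_pos_ge_half[OF rv nonneg atomless mean _ _ assms(9)] assms(8) by (simp add: T_fun_def)
qed

end
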